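(* For every $\delta > 0$ there exists $c(\delta) > 0$ such that the following holds. Let $r > s \ge 1$ be integers and set $\varepsilon = (r-s)/r$. Then $$R_{r,s}(k) \ge \exp\big( c(\delta)\, \varepsilon r \big)$$ for every integer $k \ge (1+\delta)/\varepsilon + 1$.
   Context: For positive integers $r > s \ge 1$ and $k$, the set-colouring Ramsey number $R_{r,s}(k)$ is the least $n \in \mathbb{N}$ such that every colouring $\chi \colon E(K_n) \to \binom{[r]}{s}$ (each edge of $K_n$ is assigned a set of exactly $s$ colours from $[r]$) contains a monochromatic clique of size $k$, i.e. a $k$-set $S$ of vertices and a colour $i$ with $i \in \chi(e)$ for all $e \in \binom{S}{2}$. *)

theory Defs
  imports Complex_Main "HOL-Library.Ramsey"
begin

text \<open>
  The complete graph on \<open>n\<close> vertices has vertex set \<open>{..<n}\<close> and edge set \<open>[{..<n}]\<^bsup>2\<^esup>\<close>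
  (\<^const>\<open>nsets\<close>); the palette \<open>[r]\<close> is \<open>{1..r}\<close>.
\<close>

definition set_colouring :: "nat \<Rightarrow> nat \<Rightarrow> nat \<Rightarrow> (nat set \<Rightarrow> nat set) \<Rightarrow> bool" where
  "set_colouring r s n \<chi> \<longleftrightarrow> \<chi> \<in> [{..<n}]\<^bsup>2\<^esup> \<rightarrow> [{1..r}]\<^bsup>s\<^esup>"

definition has_mono_clique :: "nat \<Rightarrow> nat \<Rightarrow> nat \<Rightarrow> (nat set \<Rightarrow> nat set) \<Rightarrow> bool" where
  "has_mono_clique r k n \<chi> \<longleftrightarrow> (\<exists>S \<in> [{..<n}]\<^bsup>k\<^esup>. \<exists>i \<in> {1..r}. \<forall>e \<in> [S]\<^bsup>2\<^esup>. i \<in> \<chi> e)"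

definition set_ramsey :: "nat \<Rightarrow> nat \<Rightarrow> nat \<Rightarrow> nat" where
  "set_ramsey r s k = (LEAST n. \<forall>\<chi>. set_colouring r s n \<chi> \<longrightarrow> has_mono_clique r k n \<chi>)"

text \<open>
  The set whose least element is taken is nonempty, so \<^const>\<open>set_ramsey\<close> is not a junk value:
  choose one colour from each \<open>\<chi> e\<close> and apply Ramsey's theorem for \<open>r\<close> colours.
\<close>

lemma set_ramsey_exists:
  assumes "1 \<le> s"
  shows "\<exists>n. \<forall>\<chi>. set_colouring r s n \<chi> \<longrightarrow> has_mono_clique r k n \<chi>"
proof -
  obtain n :: nat where n: "partn_lst {..<n} (replicate r k) 2"
    using ramsey_full by blast
  have "has_mono_clique r k n \<chi>" if \<chi>: "set_colouring r s n \<chi>" for \<chi>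
  proof -
    define f where "f e = (SOME i. i \<in> \<chi> e) - 1" for e
    have f: "f e < r \<and> Suc (f e) \<in> \<chi> e" if "e \<in> [{..<n}]\<^bsup>2\<^esup>" for e
    proof -
      have "\<chi> e \<subseteq> {1..r}" "card (\<chi> e) = s"
        using \<chi> that by (auto simp: set_colouring_def nsets_def)
      with assms have "\<chi> e \<noteq> {}" by auto
      then have "(SOME i. i \<in> \<chi> e) \<in> \<chi> e" by (simp add: some_in_eq)
      with \<open>\<chi> e \<subseteq> {1..r}\<close> show ?thesis
        unfolding f_def by (metis Suc_diff_1 Suc_le_eq One_nat_def atLeastAtMost_iff subsetD)
    qed
    then have "f \<in> [{..<n}]\<^bsup>2\<^esup> \<rightarrow> {..<r}" by auto
    then obtain i H where i: "i < r" and H: "H \<in> [{..<n}]\<^bsup>k\<^esup>" and sub: "f ` [H]\<^bsup>2\<^esup> \<subseteq> {i}"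
      using partn_lstE[OF n, of f r] by (metis length_replicate nth_replicate)
    have "[H]\<^bsup>2\<^esup> \<subseteq> [{..<n}]\<^bsup>2\<^esup>"
      using H by (intro nsets_mono) (auto simp: nsets_def)
    then have "\<forall>e \<in> [H]\<^bsup>2\<^esup>. Suc i \<in> \<chi> e"
      using f sub by blast
    moreover have "Suc i \<in> {1..r}" using i by auto
    ultimately show ?thesis
      unfolding has_mono_clique_def using H by blast
  qed
  then show ?thesis by blast
qed

end

theory Submission
  imports Defs "HOL-Library.FuncSet"
begin

text \<open>
  Put \<open>q = k - 1\<close> and \<open>t = r - s = \<epsilon> r\<close>. Label the vertices by words of length \<open>r\<close> over an
  alphabet of \<open>q\<close> letters, and let an edge \<open>u v\<close> receive colours among the positions where the words
  of \<open>u\<close> and \<open>v\<close> differ. Each colour class is then \<open>q\<close>-partite, so it has no clique of size \<open>k\<close>, and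
  the edge can be given \<open>s\<close> colours as soon as the two words agree in at most \<open>t\<close> positions.
  A maximal code with this property is large by the Gilbert--Varshamov argument: the number of words
  that agree with a fixed one in more than \<open>t\<close> positions is at most \<open>(q - 1 + x)\<^sup>r / x\<^sup>t\<close> for every
  \<open>x \<ge> 1\<close>, and \<open>x = 1 + \<delta>\<close> yields the exponent \<open>c(\<delta>) = ln (1 + \<delta>) - \<delta> / (1 + \<delta>)\<close>.
\<close>

section \<open>Codes with few agreements\<close>

text \<open>Take \<open>C\<close> maximal. A point conflicting with no member of \<open>C\<close>
  could be added to it, so the conflict sets of the members, each of size at most \<open>B\<close>,
  cover \<open>X\<close>. By \<open>refl\<close>, the members of \<open>C\<close> are covered
  too.\<close>

lemma exists_large_independent_subset:
  fixes bad :: "'a \<Rightarrow> 'a \<Rightarrow> bool"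
  assumes "finite X"
    and refl: "\<And>w. w \<in> X \<Longrightarrow> bad w w"
    and sym: "\<And>v w. bad v w \<Longrightarrow> bad w v"
    and B: "\<And>v. v \<in> X \<Longrightarrow> card {w \<in> X. bad v w} \<le> B"
  obtains C where "C \<subseteq> X" "pairwise (\<lambda>v w. \<not> bad v w) C" "card X \<le> card C * B"
proof -
  let ?F = "{C. C \<subseteq> X \<and> pairwise (\<lambda>v w. \<not> bad v w) C}"
  have "finite ?F"
    using \<open>finite X\<close> by simp
  moreover have "{} \<in> ?F"
    by simp
  ultimately obtain C where C: "C \<in> ?F" and max: "\<And>D. D \<in> ?F \<Longrightarrow> C \<subseteq> D \<Longrightarrow> C = D"
    by (metis (no_types, lifting) empty_iff finite_has_maximal)
  have "finite C"
    using C \<open>finite X\<close> finite_subset by auto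
  have "X \<subseteq> (\<Union>v\<in>C. {w \<in> X. bad v w})"
  proof
    fix w assume w: "w \<in> X"
    show "w \<in> (\<Union>v\<in>C. {w \<in> X. bad v w})"
    proof (rule ccontr)
      assume n: "w \<notin> (\<Union>v\<in>C. {w \<in> X. bad v w})"
      then have "insert w C \<in> ?F"
        using C w sym by (auto simp: pairwise_insert)
      then have "w \<in> C"
        using max by blast
      with n w refl show False
        by auto
    qed
  qed
  then have "card X \<le> card (\<Union>v\<in>C. {w \<in> X. bad v w})"
    using \<open>finite C\<close> \<open>finite X\<close> by (intro card_mono) auto
  also have "\<dots> \<le> (\<Sum>v\<in>C. card {w \<in> X. bad v w})"
    using \<open>finite C\<close> by (rule card_UN_le)
  also have "\<dots> \<le> card C * B"
    using B C sum_bounded_above[of C "\<lambda>v. card {w \<in> X. bad v w}" B] by auto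
  finally show thesis
    using that C by blast
qed

text \<open>This is the generating function of the number of agreements with \<open>v\<close>. The
  weight factors over the positions, and at each position one letter contributes \<open>x\<close>
  and the other \<open>q - 1\<close> contribute 1.\<close>

lemma sum_power_agreements:
  fixes x :: real
  assumes "finite I" and v: "v \<in> I \<rightarrow>\<^sub>E {..<q}"
  shows "(\<Sum>w \<in> I \<rightarrow>\<^sub>E {..<q}. x ^ card {i \<in> I. v i = w i}) = (real q - 1 + x) ^ card I"
proof -
  have "(\<Sum>w \<in> I \<rightarrow>\<^sub>E {..<q}. x ^ card {i \<in> I. v i = w i})
      = (\<Sum>w \<in> I \<rightarrow>\<^sub>E {..<q}. \<Prod>i\<in>I. if v i = w i then x else 1)"
    using \<open>finite I\<close> by (simp add: prod.If_cases Int_def)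
  also have "\<dots> = (\<Prod>i\<in>I. \<Sum>a<q. if v i = a then x else 1)"
    using \<open>finite I\<close> by (subst prod_sum_PiE) auto
  also have "\<dots> = (\<Prod>i\<in>I. real q - 1 + x)"
  proof (rule prod.cong[OF refl])
    fix i assume "i \<in> I"
    with v have i: "v i < q"
      by (auto simp: PiE_iff)
    have "(\<Sum>a<q. if v i = a then x else 1) = x + (\<Sum>a\<in>{..<q} - {v i}. if v i = a then x else 1)"
      using i by (subst sum.remove[of _ "v i"]) auto
    also have "(\<Sum>a\<in>{..<q} - {v i}. if v i = a then x else 1) = (\<Sum>a\<in>{..<q} - {v i}. 1)"
      by (intro sum.cong) auto
    also have "\<dots> = real q - 1"
      using i by simp
    finally show "(\<Sum>a<q. if v i = a then x else 1) = real q - 1 + x"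
      by simp
  qed
  finally show ?thesis
    by simp
qed

text \<open>Markov-type bound: since \<open>x\<close> \<ge> 1, every counted word contributes at
  least \<open>x ^ t\<close> to the generating function.\<close>

lemma card_many_agreements_le:
  fixes x :: real
  assumes "finite I" and v: "v \<in> I \<rightarrow>\<^sub>E {..<q}" and "1 \<le> x"
  shows "card {w \<in> I \<rightarrow>\<^sub>E {..<q}. t \<le> card {i \<in> I. v i = w i}} * x ^ t
    \<le> (real q - 1 + x) ^ card I" (is "real (card ?A) * _ \<le> _")
proof -
  have fin: "finite (I \<rightarrow>\<^sub>E {..<q})"
    using \<open>finite I\<close> by (intro finite_PiE) auto
  have "card ?A * x ^ t = (\<Sum>w\<in>?A. x ^ t)"
    by simp
  also have "\<dots> \<le> (\<Sum>w\<in>?A. x ^ card {i \<in> I. v i = w i})"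
    using \<open>1 \<le> x\<close> by (intro sum_mono power_increasing) auto
  also have "\<dots> \<le> (\<Sum>w \<in> I \<rightarrow>\<^sub>E {..<q}. x ^ card {i \<in> I. v i = w i})"
    using \<open>1 \<le> x\<close> fin by (intro sum_mono2) auto
  also have "\<dots> = (real q - 1 + x) ^ card I"
    using assms by (intro sum_power_agreements)
  finally show ?thesis .
qed

text \<open>The conflict relation is agreement in at least \<open>t\<close> positions. A word agrees
  with itself in \<open>card I\<close> positions, so \<open>t\<close> \<le> \<open>card I\<close>
  makes the relation reflexive.\<close>

lemma exists_code_few_agreements:
  fixes x :: real
  assumes "finite I" "t \<le> card I" "1 \<le> x" "0 < q"
  obtains C where "C \<subseteq> I \<rightarrow>\<^sub>E {..<q}"
    "pairwise (\<lambda>v w. card {i \<in> I. v i = w i} < t) C"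
    "real q ^ card I * x ^ t \<le> card C * (real q - 1 + x) ^ card I"
proof -
  let ?W = "I \<rightarrow>\<^sub>E {..<q}"
  \<comment> \<open>The covering bound counts in \<open>nat\<close>, so the real estimate is rounded
    down; a cardinality below the estimate is also below its floor.\<close>
  define B where "B = nat \<lfloor>(real q - 1 + x) ^ card I / x ^ t\<rfloor>"
  have pos: "0 \<le> (real q - 1 + x) ^ card I / x ^ t"
    using assms by simp
  have "finite ?W"
    using \<open>finite I\<close> by (intro finite_PiE) auto
  moreover have "card {w \<in> ?W. t \<le> card {i \<in> I. v i = w i}} \<le> B" if "v \<in> ?W" for v
    unfolding B_def using card_many_agreements_le[OF assms(1) that \<open>1 \<le> x\<close>, of t] \<open>1 \<le> x\<close>
    by (simp add: le_nat_floor field_simps)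
  ultimately obtain C where C: "C \<subseteq> ?W"
    "pairwise (\<lambda>v w. \<not> t \<le> card {i \<in> I. v i = w i}) C" "card ?W \<le> card C * B"
    using exists_large_independent_subset[of ?W "\<lambda>v w. t \<le> card {i \<in> I. v i = w i}" B] assms(2)
    by (auto simp: eq_commute)
  have "real q ^ card I = card ?W"
    using \<open>finite I\<close> by (simp add: card_PiE)
  also have "\<dots> \<le> real (card C) * B"
    using C(3) by (simp flip: of_nat_mult)
  also have "\<dots> \<le> card C * ((real q - 1 + x) ^ card I / x ^ t)"
    unfolding B_def using pos by (intro mult_left_mono) auto
  finally have "real q ^ card I * x ^ t \<le> card C * (real q - 1 + x) ^ card I"
    using \<open>1 \<le> x\<close> by (simp add: field_simps)
  with C show thesis
    using that by (simp add: not_le)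
qed

section \<open>From codes to colourings\<close>

text \<open>Restricting a clique-free colouring to fewer vertices keeps it clique-free, so the least
  good number cannot be at most \<open>n\<close>.\<close>

lemma set_ramsey_gt:
  assumes "1 \<le> s" and \<chi>: "set_colouring r s n \<chi>" and no: "\<not> has_mono_clique r k n \<chi>"
  shows "n < set_ramsey r s k"
proof (rule ccontr)
  define m where "m = set_ramsey r s k"
  assume "\<not> n < set_ramsey r s k"
  then have "m \<le> n"
    by (simp add: m_def)
  have "\<forall>\<chi>. set_colouring r s m \<chi> \<longrightarrow> has_mono_clique r k m \<chi>"
    unfolding m_def set_ramsey_def using set_ramsey_exists[OF \<open>1 \<le> s\<close>] by (rule LeastI_ex)
  moreover have sub: "[{..<m}]\<^bsup>j\<^esup> \<subseteq> [{..<n}]\<^bsup>j\<^esup>" for j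
    using \<open>m \<le> n\<close> by (intro nsets_mono) auto
  then have "set_colouring r s m \<chi>"
    using \<chi> by (auto simp: set_colouring_def)
  ultimately have "has_mono_clique r k m \<chi>"
    by blast
  with sub no show False
    unfolding has_mono_clique_def by blast
qed

lemma set_ramsey_gt_card_code:
  assumes "1 \<le> s" "s \<le> r" and C: "C \<subseteq> {1..r} \<rightarrow>\<^sub>E {..<q}"
    and few: "pairwise (\<lambda>v w. card {i \<in> {1..r}. v i = w i} \<le> r - s) C"
    and "q < k"
  shows "card C < set_ramsey r s k"
proof -
  have "finite C"
    using C by (rule finite_subset) (intro finite_PiE; simp)
  then obtain f where f: "bij_betw f {..<card C} C"
    using ex_bij_betw_nat_finite[of C] by (auto simp: atLeast0LessThan)
  \<comment> \<open>Injectivity on \<open>e\<close> encodes "the two words differ at position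
    \<open>i\<close>" as a property of the unordered edge.\<close>
  define D where "D e = {i \<in> {1..r}. inj_on (\<lambda>a. f a i) e}" for e
  have "\<exists>T \<subseteq> D e. card T = s" if e: "e \<in> [{..<card C}]\<^bsup>2\<^esup>" for e
  proof -
    obtain a b where ab: "e = {a, b}" "a \<noteq> b" "a < card C" "b < card C"
      using e by (auto simp: nsets_def card_2_iff)
    have "f a \<in> C" "f b \<in> C" "f a \<noteq> f b"
      using f ab by (auto simp: bij_betw_def inj_on_def)
    then have "card {i \<in> {1..r}. f a i = f b i} \<le> r - s"
      using few by (auto simp: pairwise_def)
    moreover have "D e = {1..r} - {i \<in> {1..r}. f a i = f b i}"
      using ab by (auto simp: D_def)
    moreover have "card ({1..r} - {i \<in> {1..r}. f a i = f b i})
        = card {1..r} - card {i \<in> {1..r}. f a i = f b i}"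
      by (rule card_Diff_subset) auto
    ultimately have "s \<le> card (D e)"
      using \<open>s \<le> r\<close> by simp
    then show ?thesis
      by (meson obtain_subset_with_card_n)
  qed
  then obtain \<chi> where \<chi>: "\<And>e. e \<in> [{..<card C}]\<^bsup>2\<^esup> \<Longrightarrow> \<chi> e \<subseteq> D e \<and> card (\<chi> e) = s"
    by metis
  have "set_colouring r s (card C) \<chi>"
    unfolding set_colouring_def
  proof
    fix e assume "e \<in> [{..<card C}]\<^bsup>2\<^esup>"
    then have "\<chi> e \<subseteq> {1..r}" "card (\<chi> e) = s"
      using \<chi>[of e] by (auto simp: D_def)
    then show "\<chi> e \<in> [{1..r}]\<^bsup>s\<^esup>"
      by (auto simp: nsets_def intro: finite_subset)
  qed
  moreover have "\<not> has_mono_clique r k (card C) \<chi>"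
  proof
    assume "has_mono_clique r k (card C) \<chi>"
    then obtain S i where S: "S \<in> [{..<card C}]\<^bsup>k\<^esup>" and i: "i \<in> {1..r}"
      and mono: "\<And>e. e \<in> [S]\<^bsup>2\<^esup> \<Longrightarrow> i \<in> \<chi> e"
      by (auto simp: has_mono_clique_def)
    have "(\<lambda>a. f a i) ` S \<subseteq> {..<q}"
    proof clarify
      fix a assume "a \<in> S"
      with S f have "f a \<in> C"
        by (auto simp: nsets_def bij_betw_def)
      with C i show "f a i < q"
        by (auto simp: PiE_iff)
    qed
    \<comment> \<open>Pigeonhole: \<open>k\<close> > \<open>q\<close> words must repeat a letter at
      position \<open>i\<close>, yet colour \<open>i\<close> is only available on edges whose words
      differ there.\<close>
    then have "card ((\<lambda>a. f a i) ` S) \<le> q"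
      using card_mono[of "{..<q}"] by simp
    with S \<open>q < k\<close> have "\<not> inj_on (\<lambda>a. f a i) S"
      by (auto simp: nsets_def card_image)
    then obtain a b where ab: "a \<in> S" "b \<in> S" "a \<noteq> b" "f a i = f b i"
      by (auto simp: inj_on_def)
    then have "{a, b} \<in> [S]\<^bsup>2\<^esup>" "{a, b} \<in> [{..<card C}]\<^bsup>2\<^esup>"
      using S by (auto simp: nsets_def)
    then have "i \<in> D {a, b}"
      using mono \<chi> by blast
    with ab show False
      by (simp add: D_def)
  qed
  ultimately show ?thesis
    using \<open>1 \<le> s\<close> by (intro set_ramsey_gt)
qed

section \<open>The exponent and the final bound\<close>

lemma rate_pos:
  fixes \<delta> :: real
  assumes "0 < \<delta>"
  shows "0 < ln (1 + \<delta>) - \<delta> / (1 + \<delta>)"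
proof -
  \<comment> \<open>The inequality ln y \<le> y - 1 is an equality only at y = 1, and here y <
    1.\<close>
  have "ln (1 / (1 + \<delta>)) < 1 / (1 + \<delta>) - 1"
    using ln_le_minus_one[of "1 / (1 + \<delta>)"] ln_eq_minus_one[of "1 / (1 + \<delta>)"] assms
    by fastforce
  then show ?thesis
    using assms by (simp add: ln_div field_simps)
qed

text \<open>With t = r - s and x = 1 + \<delta> the code has at least
  \<open>(1 + \<delta>) ^ t / (1 + \<delta> / q) ^ r\<close> words. The denominator is at most
  \<open>exp (\<delta> * r / q)\<close>, and the hypothesis on \<open>q\<close> says r / q \<le> t /
  (1 + \<delta>).\<close>

lemma exp_rate_le_set_ramsey:
  fixes \<delta> :: real and r s q k :: nat
  assumes "0 < \<delta>" "1 \<le> s" "s < r" "q < k" and q: "(1 + \<delta>) * r \<le> real q * real (r - s)"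
  shows "exp ((ln (1 + \<delta>) - \<delta> / (1 + \<delta>)) * real (r - s)) \<le> set_ramsey r s k"
proof -
  let ?t = "r - s"
  have "0 < (1 + \<delta>) * r"
    using assms by simp
  with q have "0 < q"
    by (cases q) auto
  have "Suc ?t \<le> r"
    using assms by simp
  \<comment> \<open>Asking for fewer than \<open>t + 1\<close> agreements makes every word conflict with itself, as \<open>t + 1 \<le> r\<close>.\<close>
  obtain C where C: "C \<subseteq> {1..r} \<rightarrow>\<^sub>E {..<q}"
    "pairwise (\<lambda>v w. card {i \<in> {1..r}. v i = w i} < Suc ?t) C"
    "real q ^ r * (1 + \<delta>) ^ Suc ?t \<le> card C * (real q - 1 + (1 + \<delta>)) ^ r"
    using exists_code_few_agreements[of "{1..r}" "Suc ?t" "1 + \<delta>" q] assms(1) \<open>0 < q\<close>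
      \<open>Suc ?t \<le> r\<close> by auto
  have "exp (ln (1 + \<delta>) * ?t) = (1 + \<delta>) ^ ?t"
    using assms(1) by (simp add: exp_of_nat2_mult)
  \<comment> \<open>The surplus factor 1 + \<delta> coming from \<open>Suc ?t\<close> is given
    away.\<close>
  also have "real q ^ r * (1 + \<delta>) ^ ?t \<le> real q ^ r * (1 + \<delta>) ^ Suc ?t"
    using assms(1) by (intro mult_left_mono power_increasing) auto
  then have "(1 + \<delta>) ^ ?t \<le> card C * ((real q + \<delta>) ^ r / real q ^ r)"
    using C(3) \<open>0 < q\<close> by (simp add: field_simps)
  also have "(real q + \<delta>) ^ r / real q ^ r = (1 + \<delta> / q) ^ r"
    using \<open>0 < q\<close> by (simp add: power_divide[symmetric] add_divide_distrib)
  also have "\<dots> \<le> exp (\<delta> / q) ^ r"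
    using assms(1) by (intro power_mono exp_ge_add_one_self) auto
  also have "\<dots> = exp (\<delta> * (r / q))"
    by (simp flip: exp_of_nat_mult add: mult.commute)
  also have "r / q \<le> ?t / (1 + \<delta>)"
    using q \<open>0 < q\<close> assms(1) by (simp add: field_simps)
  finally have "exp (ln (1 + \<delta>) * ?t) \<le> card C * exp (\<delta> * (?t / (1 + \<delta>)))"
    using assms(1) by (simp add: mult_left_mono)
  then have "exp ((ln (1 + \<delta>) - \<delta> / (1 + \<delta>)) * ?t) \<le> card C"
    by (simp add: left_diff_distrib exp_diff field_simps)
  also have "card C < set_ramsey r s k"
    using assms C by (intro set_ramsey_gt_card_code[of s r C q]) (auto simp: less_Suc_eq_le)
  finally show ?thesis
    by simp
qed

theorem theorem4p2:
  shows "\<forall>\<delta>::real. \<delta> > 0 \<longrightarrow> (\<exists>c::real. c > 0 \<and>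
    (\<forall>(r::nat) (s::nat) (\<epsilon>::real). r > s \<longrightarrow> s \<ge> 1 \<longrightarrow> \<epsilon> = (real r - real s) / real r \<longrightarrow>
      (\<forall>k::nat. real k \<ge> (1 + \<delta>) / \<epsilon> + 1 \<longrightarrow>
        real (set_ramsey r s k) \<ge> exp (c * \<epsilon> * real r))))"
proof (intro allI impI)
  fix \<delta> :: real assume "\<delta> > 0"
  show "\<exists>c::real. c > 0 \<and>
    (\<forall>(r::nat) (s::nat) (\<epsilon>::real). r > s \<longrightarrow> s \<ge> 1 \<longrightarrow> \<epsilon> = (real r - real s) / real r \<longrightarrow>
      (\<forall>k::nat. real k \<ge> (1 + \<delta>) / \<epsilon> + 1 \<longrightarrow>
        real (set_ramsey r s k) \<ge> exp (c * \<epsilon> * real r)))"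
  proof (intro exI[of _ "ln (1 + \<delta>) - \<delta> / (1 + \<delta>)"] conjI allI impI)
    show "0 < ln (1 + \<delta>) - \<delta> / (1 + \<delta>)"
      using \<open>\<delta> > 0\<close> by (rule rate_pos)
    fix r s k :: nat and \<epsilon> :: real
    assume rs: "r > s" "s \<ge> 1" and \<epsilon>: "\<epsilon> = (real r - real s) / real r"
      and k: "real k \<ge> (1 + \<delta>) / \<epsilon> + 1"
    have "\<epsilon> > 0"
      using rs \<epsilon> by simp
    then have "(1 + \<delta>) / \<epsilon> > 0"
      using \<open>\<delta> > 0\<close> by simp
    \<comment> \<open>This makes the natural subtraction in \<open>q = k - 1\<close>
      genuine.\<close>
    with k have "k \<ge> 1"
      by linarith
    have \<epsilon>r: "\<epsilon> * r = real (r - s)"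
      using rs \<epsilon> by simp
    have "1 + \<delta> \<le> real (k - 1) * \<epsilon>"
      using k \<open>\<epsilon> > 0\<close> \<open>k \<ge> 1\<close> by (simp add: field_simps of_nat_diff)
    then have "(1 + \<delta>) * r \<le> real (k - 1) * \<epsilon> * r"
      by (intro mult_right_mono) auto
    then have "(1 + \<delta>) * r \<le> real (k - 1) * real (r - s)"
      by (simp only: mult.assoc \<epsilon>r)
    then show "exp ((ln (1 + \<delta>) - \<delta> / (1 + \<delta>)) * \<epsilon> * r) \<le> set_ramsey r s k"
      using exp_rate_le_set_ramsey[of \<delta> s r "k - 1" k] \<open>\<delta> > 0\<close> rs \<open>k \<ge> 1\<close>
      by (simp add: mult.assoc \<epsilon>r)
  qed
qed

end
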